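(* For all integers $n\ge r\ge 2$, $$ \sum_{\substack{j_1+\cdots+j_r=n\\ j_1,\dots,j_r\ge 1}}B_{j_1}\cdots B_{j_r} =\sum_{m=0}^{\lfloor (n-r+1)/2\rfloor}\binom{n-m-1}{r-2}\binom{m+r-2}{r-2}\frac{n-2 m-r+1}{r-1}B_{n-2 m-r+1}\,. $$
   Context: The balancing numbers $B_n$ are defined by $B_0=0$, $B_1=1$ and $B_n=6B_{n-1}-B_{n-2}$ for $n\ge 2$. The sum on the left is over ordered $r$-tuples of positive integers summing to $n$. *)

theory Defs
  imports Complex_Main
begin

fun balancing :: "nat \<Rightarrow> int" where
  "balancing 0 = 0"
| "balancing (Suc 0) = 1"
| "balancing (Suc (Suc n)) = 6 * balancing (Suc n) - balancing n"

definition compositions :: "nat \<Rightarrow> nat \<Rightarrow> nat list set" where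
  "compositions r n = {js. length js = r \<and> sum_list js = n \<and> (\<forall>j\<in>set js. 1 \<le> j)}"

lemma finite_compositions: "finite (compositions r n)"
proof (rule finite_subset)
  show "compositions r n \<subseteq> {js. set js \<subseteq> {..n} \<and> length js = r}"
    by (auto simp: compositions_def member_le_sum_list)
  show "finite {js. set js \<subseteq> {..n} \<and> length js = r}"
    by (rule finite_lists_length_eq) simp
qed

end

theory Submission
  imports Defs
begin

text \<open>
  Write \<open>S\<^sub>r n\<close> for the left-hand side. Removing the first part of a composition shows that
  \<open>S\<^sub>r\<^sub>+\<^sub>1\<close> is the convolution of the balancing numbers with \<open>S\<^sub>r\<close>, so
  \<open>S\<^sub>r\<^sub>+\<^sub>1 (n + 2) - 6 S\<^sub>r\<^sub>+\<^sub>1 (n + 1) + S\<^sub>r\<^sub>+\<^sub>1 n = S\<^sub>r (n + 1)\<close>.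
  The right-hand side is a sum of \<open>c\<^sub>r(k, m) B\<^sub>k\<close> over \<open>k + 2 m = n - r + 1\<close>. Rewriting
  \<open>6 B\<^sub>k = B\<^sub>k\<^sub>+\<^sub>1 + B\<^sub>k\<^sub>-\<^sub>1\<close> and comparing coefficients of \<open>B\<^sub>k\<close>, it obeys the same recurrence as soon as
  \<open>c\<^sub>r\<^sub>+\<^sub>1(k, m) - c\<^sub>r\<^sub>+\<^sub>1(k - 1, m) - c\<^sub>r\<^sub>+\<^sub>1(k + 1, m - 1) + c\<^sub>r\<^sub>+\<^sub>1(k, m - 1) = c\<^sub>r(k, m)\<close>,
  which is an identity between binomial coefficients.
\<close>

section \<open>Composition sums and their recurrence\<close>

definition balancing_conv :: "nat \<Rightarrow> nat \<Rightarrow> int" where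
  "balancing_conv r n = (\<Sum>js\<in>compositions r n. \<Prod>j\<leftarrow>js. balancing j)"

lemma compositions_0: "compositions 0 n = (if n = 0 then {[]} else {})"
  by (auto simp: compositions_def)

lemma compositions_Suc:
  "compositions (Suc r) n = (\<Union>j\<in>{1..n}. (#) j ` compositions r (n - j))"
proof (intro set_eqI iffI)
  fix js assume "js \<in> compositions (Suc r) n"
  then show "js \<in> (\<Union>j\<in>{1..n}. (#) j ` compositions r (n - j))"
    by (cases js) (auto simp: compositions_def intro!: bexI[of _ "hd js"])
qed (auto simp: compositions_def)

lemma balancing_conv_0: "balancing_conv 0 n = (if n = 0 then 1 else 0)"
  by (simp add: balancing_conv_def compositions_0)

lemma balancing_conv_Suc:
  "balancing_conv (Suc r) n = (\<Sum>j\<le>n. balancing j * balancing_conv r (n - j))"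
proof -
  have "balancing_conv (Suc r) n =
      (\<Sum>j\<in>{1..n}. \<Sum>js\<in>(#) j ` compositions r (n - j). \<Prod>j\<leftarrow>js. balancing j)"
    unfolding balancing_conv_def compositions_Suc
    by (rule sum.UNION_disjoint) (auto simp: finite_compositions)
  also have "\<dots> = (\<Sum>j\<in>{1..n}. balancing j * balancing_conv r (n - j))"
    by (rule sum.cong) (auto simp: balancing_conv_def sum.reindex sum_distrib_left)
  also have "\<dots> = (\<Sum>j\<le>n. balancing j * balancing_conv r (n - j))"
    by (rule sum.mono_neutral_left) (auto simp: not_le)
  finally show ?thesis .
qed

lemma balancing_conv_1: "balancing_conv (Suc 0) n = balancing n"
proof -
  have "balancing_conv (Suc 0) n = (\<Sum>j\<le>n. if j = n then balancing j else 0)"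
    unfolding balancing_conv_Suc by (rule sum.cong) (auto simp: balancing_conv_0)
  then show ?thesis by simp
qed

text \<open>The balancing numbers have generating function \<open>x / (1 - 6 * x + x^2)\<close>;
  multiplying the convolution by the denominator leaves \<open>x\<close> times the series of
  \<open>g\<close>.\<close>

lemma balancing_convolution_rec:
  fixes g :: "nat \<Rightarrow> int"
  defines "h \<equiv> \<lambda>n. \<Sum>j\<le>n. balancing j * g (n - j)"
  shows "h (n + 2) = 6 * h (n + 1) - h n + g (n + 1)"
proof -
  \<comment> \<open>Splitting off the first terms puts all three sums over \<open>j \<le> n\<close>
    with the common factor \<open>g (n - j)\<close>.\<close>
  have "h (n + 2) = g (n + 1) + (\<Sum>j\<le>n. balancing (Suc (Suc j)) * g (n - j))"
    unfolding h_def by (simp add: sum.atMost_Suc_shift del: sum.atMost_Suc)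
  moreover have "h (n + 1) = (\<Sum>j\<le>n. balancing (Suc j) * g (n - j))"
    unfolding h_def by (simp add: sum.atMost_Suc_shift del: sum.atMost_Suc)
  ultimately show ?thesis
    by (simp add: h_def algebra_simps sum_subtractf sum_distrib_left)
qed

lemma balancing_conv_rec:
  "balancing_conv (Suc r) (n + 2) =
    6 * balancing_conv (Suc r) (n + 1) - balancing_conv (Suc r) n + balancing_conv r (n + 1)"
  unfolding balancing_conv_Suc by (rule balancing_convolution_rec)

lemma balancing_conv_eq_0: "n < r \<Longrightarrow> balancing_conv r n = 0"
proof (induction r arbitrary: n)
  case (Suc r)
  have "balancing j * balancing_conv r (n - j) = 0" if "j \<le> n" for j
    using that Suc by (cases j) auto
  then show ?case
    unfolding balancing_conv_Suc by (intro sum.neutral) auto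
qed simp

text \<open>The recurrence links consecutive diagonal values, since its other two terms run over no
  compositions at all.\<close>

lemma balancing_conv_self: "balancing_conv (Suc r) (Suc r) = 1"
proof (induction r)
  case 0
  show ?case by (simp add: balancing_conv_1)
next
  case (Suc r)
  then show ?case
    using balancing_conv_rec[of "Suc r" r] by (simp add: balancing_conv_eq_0)
qed

section \<open>Coefficients and their binomial identity\<close>

text \<open>\<open>conv_coeff (r - 1) k m\<close> is the coefficient \<open>c\<^sub>r(k, m)\<close>; the first clause extends the
  formula to \<open>r = 1\<close>.\<close>

fun conv_coeff :: "nat \<Rightarrow> nat \<Rightarrow> nat \<Rightarrow> real" where
  "conv_coeff 0 k m = (if m = 0 then 1 else 0)"
| "conv_coeff (Suc s) k m =
    real k / real (Suc s) * real ((k + m + s) choose s) * real ((m + s) choose s)"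

text \<open>Expressing all binomials through \<open>(x + s) choose s\<close> makes the coefficient
  identity a rational one.\<close>

lemma choose_add_Suc_upper:
  "real ((x + Suc s) choose Suc s) = (real x + real s + 1) / (real s + 1) * real ((x + s) choose s)"
proof -
  have "real (Suc s * (Suc (x + s) choose Suc s)) = real (Suc (x + s) * ((x + s) choose s))"
    by (simp only: Suc_times_binomial)
  then show ?thesis by (simp add: field_simps)
qed

lemma choose_add_Suc_lower:
  "real ((x + s) choose Suc s) = real x / (real s + 1) * real ((x + s) choose s)"
proof -
  have "real ((x + Suc s) choose Suc s) = real ((x + s) choose s) + real ((x + s) choose Suc s)"
    by simp
  then show ?thesis
    unfolding choose_add_Suc_upper by (simp add: field_simps)
qed

text \<open>Boundary case \<open>m = 0\<close>, where the terms with \<open>m - 1\<close> are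
  absent.\<close>

lemma conv_coeff_rec_0:
  "conv_coeff (Suc r) (Suc k) 0 = conv_coeff (Suc r) k 0 + conv_coeff r (Suc k) 0"
proof (cases r)
  case (Suc s)
  have u: "real (Suc (Suc (k + s)) choose Suc s) =
      (real k + real s + 2) / (real s + 1) * real (Suc (k + s) choose s)"
    using choose_add_Suc_upper[of "Suc k" s] by simp
  have l: "real (Suc (k + s) choose Suc s) =
      (real k + 1) / (real s + 1) * real (Suc (k + s) choose s)"
    using choose_add_Suc_lower[of "Suc k" s] by simp
  show ?thesis
    using u l by (simp add: Suc del: binomial_Suc_Suc) (simp add: divide_simps, simp add: algebra_simps)
qed simp

lemma conv_coeff_rec_Suc:
  "conv_coeff (Suc r) (Suc k) (Suc m) = conv_coeff (Suc r) k (Suc m)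
    + conv_coeff (Suc r) (Suc (Suc k)) m - conv_coeff (Suc r) (Suc k) m
    + conv_coeff r (Suc k) (Suc m)"
proof (cases r)
  case (Suc s)
  \<comment> \<open>Every term of the identity is \<open>X * Y\<close> times a rational function of
    \<open>k\<close>, \<open>m\<close> and \<open>d\<close>.\<close>
  define X where "X = real ((Suc (Suc (k + m)) + s) choose s)"
  define Y where "Y = real ((Suc m + s) choose s)"
  define d where "d = real s + 1"
  have d: "d > 0" by (simp add: d_def)
  have p: "real ((Suc (Suc (k + m)) + Suc s) choose Suc s) = (real k + real m + 2 + d) / d * X"
    and p': "real ((Suc (Suc (k + m)) + s) choose Suc s) = (real k + real m + 2) / d * X"
    and q: "real ((Suc m + Suc s) choose Suc s) = (real m + 1 + d) / d * Y"
    and q': "real ((Suc m + s) choose Suc s) = (real m + 1) / d * Y"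
    unfolding choose_add_Suc_upper choose_add_Suc_lower by (simp_all add: X_def Y_def d_def add_ac)
  have "conv_coeff (Suc r) (Suc k) (Suc m) = (real k + 1) / (d + 1) *
      ((real k + real m + 2 + d) / d * X) * ((real m + 1 + d) / d * Y)"
    unfolding p[symmetric] q[symmetric] by (simp add: Suc d_def add_ac del: binomial_Suc_Suc)
  moreover have "conv_coeff (Suc r) k (Suc m) = real k / (d + 1) *
      ((real k + real m + 2) / d * X) * ((real m + 1 + d) / d * Y)"
    unfolding p'[symmetric] q[symmetric] by (simp add: Suc d_def add_ac del: binomial_Suc_Suc)
  moreover have "conv_coeff (Suc r) (Suc (Suc k)) m = (real k + 2) / (d + 1) *
      ((real k + real m + 2 + d) / d * X) * ((real m + 1) / d * Y)"
    unfolding p[symmetric] q'[symmetric] by (simp add: Suc d_def add_ac del: binomial_Suc_Suc)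
  moreover have "conv_coeff (Suc r) (Suc k) m = (real k + 1) / (d + 1) *
      ((real k + real m + 2) / d * X) * ((real m + 1) / d * Y)"
    unfolding p'[symmetric] q'[symmetric] by (simp add: Suc d_def add_ac del: binomial_Suc_Suc)
  moreover have "conv_coeff r (Suc k) (Suc m) = (real k + 1) / d * X * Y"
    by (simp add: Suc d_def X_def Y_def add_ac del: binomial_Suc_Suc)
  moreover have "d + 1 \<noteq> 0" "d \<noteq> 0" using d by auto
  ultimately show ?thesis
    by (simp only:) (simp add: divide_simps, simp add: algebra_simps)
qed simp

section \<open>The right-hand side and its recurrence\<close>

text \<open>Truncated subtraction is harmless here: terms with \<open>2 * m \<ge> N\<close> vanish because
  \<open>balancing 0 = 0\<close>.\<close>

definition coeff_sum :: "nat \<Rightarrow> nat \<Rightarrow> real" where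
  "coeff_sum r N = (\<Sum>m\<le>N. conv_coeff r (N - 2 * m) m * real_of_int (balancing (N - 2 * m)))"

text \<open>Lets sums with different \<open>N\<close> share one range of summation.\<close>

lemma coeff_sum_eq:
  assumes "N div 2 \<le> M"
  shows "coeff_sum r N =
    (\<Sum>m\<le>M. conv_coeff r (N - 2 * m) m * real_of_int (balancing (N - 2 * m)))"
proof -
  define t where "t m = conv_coeff r (N - 2 * m) m * real_of_int (balancing (N - 2 * m))" for m
  have "t m = 0" if "m > N div 2" for m
  proof -
    have "N - 2 * m = 0" using that by linarith
    then show ?thesis by (simp add: t_def)
  qed
  then have "sum t {..K} = sum t {..N div 2}" if "N div 2 \<le> K" for K
    using that by (intro sum.mono_neutral_right) auto
  from this[of N] this[of M] assms show ?thesis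
    unfolding coeff_sum_def t_def[symmetric] by simp
qed

lemma coeff_sum_rec:
  "coeff_sum (Suc r) (N + 2) =
    6 * coeff_sum (Suc r) (N + 1) - coeff_sum (Suc r) N + coeff_sum r (N + 2)"
proof -
  let ?b = "\<lambda>k. real_of_int (balancing k)"
  define c where "c = conv_coeff (Suc r)"
  \<comment> \<open>The index at level \<open>N + 2\<close>; level \<open>N\<close> uses the same
    indices with \<open>m\<close> shifted by one.\<close>
  define k where "k m = N + 2 - 2 * m" for m
  have c0: "c 0 m = 0" for m by (simp add: c_def)
  have kS: "k (Suc m) = N - 2 * m" for m by (simp add: k_def)
  have A: "coeff_sum (Suc r) (N + 2) = (\<Sum>m\<le>Suc N. c (k m) m * ?b (k m))"
    and D: "coeff_sum r (N + 2) = (\<Sum>m\<le>Suc N. conv_coeff r (k m) m * ?b (k m))"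
    unfolding c_def k_def by (rule coeff_sum_eq, simp)+
  have C: "coeff_sum (Suc r) N = (\<Sum>m\<le>N. c (k (Suc m)) m * ?b (k (Suc m)))"
    unfolding coeff_sum_def c_def kS ..
  \<comment> \<open>The balancing recurrence centred at \<open>N + 1 - 2 * m\<close>. Once that
    index truncates to 0, every term vanishes, the first on the right by \<open>c0\<close>.\<close>
  have split: "6 * (c (N + 1 - 2 * m) m * ?b (N + 1 - 2 * m)) =
      c (k m - 1) m * ?b (k m) + c (Suc (k (Suc m))) m * ?b (k (Suc m))" for m
  proof (cases "2 * m \<le> N")
    case True
    then obtain i where "N = 2 * m + i" using le_Suc_ex by blast
    then show ?thesis by (simp add: k_def algebra_simps)
  next
    case False
    then show ?thesis by (simp add: k_def c0)
  qed
  have "6 * coeff_sum (Suc r) (N + 1) = (\<Sum>m\<le>Suc N. c (k m - 1) m * ?b (k m))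
      + (\<Sum>m\<le>Suc N. c (Suc (k (Suc m))) m * ?b (k (Suc m)))"
    unfolding coeff_sum_def
    by (simp only: sum_distrib_left c_def[symmetric] split sum.distrib) simp
  also have "(\<Sum>m\<le>Suc N. c (Suc (k (Suc m))) m * ?b (k (Suc m))) =
      (\<Sum>m\<le>N. c (Suc (k (Suc m))) m * ?b (k (Suc m)))"
    by (simp add: k_def)
  finally have B: "6 * coeff_sum (Suc r) (N + 1) = (\<Sum>m\<le>Suc N. c (k m - 1) m * ?b (k m))
      + (\<Sum>m\<le>N. c (Suc (k (Suc m))) m * ?b (k (Suc m)))" .
  \<comment> \<open>For positive \<open>k (Suc m)\<close> this is the coefficient identity;
    otherwise \<open>balancing 0 = 0\<close> kills every term.\<close>
  have step: "c (k (Suc m)) (Suc m) * ?b (k (Suc m)) =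
      c (k (Suc m) - 1) (Suc m) * ?b (k (Suc m)) + c (Suc (k (Suc m))) m * ?b (k (Suc m))
      - c (k (Suc m)) m * ?b (k (Suc m)) + conv_coeff r (k (Suc m)) (Suc m) * ?b (k (Suc m))" for m
  proof (cases "k (Suc m)")
    case (Suc i)
    show ?thesis
      unfolding Suc c_def conv_coeff_rec_Suc[of r i m] diff_Suc_1 by (simp only: algebra_simps)
  qed simp
  have step0: "c (k 0) 0 * ?b (k 0) =
      c (k 0 - 1) 0 * ?b (k 0) + conv_coeff r (k 0) 0 * ?b (k 0)"
    using conv_coeff_rec_0[of r "Suc N"] by (simp add: c_def k_def algebra_simps del: conv_coeff.simps)
  show ?thesis
    unfolding A B C D sum.atMost_Suc_shift step step0
    by (simp only: sum.distrib sum_subtractf)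
qed

lemma coeff_sum_0: "coeff_sum 0 N = real_of_int (balancing N)"
proof -
  have "coeff_sum 0 N = (\<Sum>m\<le>N. if m = 0 then real_of_int (balancing N) else 0)"
    unfolding coeff_sum_def by (rule sum.cong) auto
  then show ?thesis by simp
qed

section \<open>Comparison of the two sides\<close>

lemma balancing_conv_eq_coeff_sum:
  "real_of_int (balancing_conv (Suc r) (N + r)) = coeff_sum r N"
proof (induction r arbitrary: N)
  case 0
  show ?case by (simp add: balancing_conv_1 coeff_sum_0)
next
  case (Suc r)
  note IH = Suc.IH
  show ?case
  \<comment> \<open>Both sides start with 0 and 1 and obey the same recurrence; the outer hypothesis
    at \<open>N + 2\<close> matches the inhomogeneous terms.\<close>
  proof (induction N rule: induct_nat_012)
    case 0
    show ?case by (simp add: balancing_conv_eq_0 coeff_sum_def)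
  next
    case 1
    show ?case
      using balancing_conv_self[of "Suc r"] by (simp add: coeff_sum_def)
  next
    case (ge2 N)
    show ?case
      using ge2 IH[of "N + 2"] coeff_sum_rec[of r N] balancing_conv_rec[of "Suc r" "N + Suc r"]
      by simp
  qed
qed

theorem theorem5:
  fixes n r :: nat
  assumes "n \<ge> r" and "r \<ge> 2"
  shows "real_of_int (\<Sum>js\<in>compositions r n. \<Prod>j\<leftarrow>js. balancing j) =
    (\<Sum>m = 0..(n - r + 1) div 2.
       real ((n - m - 1) choose (r - 2)) * real ((m + r - 2) choose (r - 2)) *
       ((real n - 2 * real m - real r + 1) / (real r - 1)) *
       real_of_int (balancing (n + 1 - r - 2 * m)))"
proof -
  obtain s where r: "r = Suc (Suc s)"
    using assms(2) by (metis add_2_eq_Suc le_Suc_ex)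
  define N where "N = n - r + 1"
  have n: "n = N + Suc s" using assms(1) by (simp add: N_def r)
  have "real_of_int (\<Sum>js\<in>compositions r n. \<Prod>j\<leftarrow>js. balancing j) = coeff_sum (Suc s) N"
    unfolding balancing_conv_def[symmetric] r n by (rule balancing_conv_eq_coeff_sum)
  also have "\<dots> = (\<Sum>m\<le>N div 2.
      conv_coeff (Suc s) (N - 2 * m) m * real_of_int (balancing (N - 2 * m)))"
    by (rule coeff_sum_eq) simp
  also have "\<dots> = (\<Sum>m = 0..N div 2.
       real ((n - m - 1) choose (r - 2)) * real ((m + r - 2) choose (r - 2)) *
       ((real n - 2 * real m - real r + 1) / (real r - 1)) *
       real_of_int (balancing (n + 1 - r - 2 * m)))"
    unfolding atMost_atLeast0
  proof (rule sum.cong)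
    fix m assume "m \<in> {0..N div 2}"
    then have "2 * m \<le> N" by auto
    \<comment> \<open>Writing \<open>N = 2 * m + k\<close> makes all truncated subtractions
      exact.\<close>
    then obtain k where k: "N = 2 * m + k" using le_Suc_ex by blast
    have "n - m - 1 = k + m + s" "m + r - 2 = m + s" "n + 1 - r - 2 * m = k" "N - 2 * m = k"
      "real n - 2 * real m - real r + 1 = real k" "real r - 1 = real (Suc s)" "r - 2 = s"
      by (simp_all add: n r k)
    then show "conv_coeff (Suc s) (N - 2 * m) m * real_of_int (balancing (N - 2 * m)) =
       real ((n - m - 1) choose (r - 2)) * real ((m + r - 2) choose (r - 2)) *
       ((real n - 2 * real m - real r + 1) / (real r - 1)) *
       real_of_int (balancing (n + 1 - r - 2 * m))"
      by (simp only: conv_coeff.simps) (simp only: mult_ac)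
  qed simp
  finally show ?thesis unfolding N_def .
qed

end
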